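(* Let $\Sigma$ be a discrete-time linear system given by bounded Hilbert space operators $(A,B,C,D)$ whose transfer function $F_\Sigma$ has an analytic continuation to a function in the Schur class $\mathcal S(\mathcal U,\mathcal Y)$. For $x_0\in\mathcal X$ define the available storage $$S_a(x_0)=\sup_{\mathbf u,\ n_1\ge0}\ \sum_{n=0}^{n_1}\left(\|\mathbf y(n)\|^2-\|\mathbf u(n)\|^2\right),$$ the supremum being over all system trajectories $(\mathbf u(n),\mathbf x(n),\mathbf y(n))_{n\ge0}$ with $\mathbf x(0)=x_0$ and all $n_1\ge 0$, and the required supply $$S_r(x_0)=\inf_{\mathbf u,\ n_{-1}<0}\ \sum_{n=n_{-1}}^{-1}\left(\|\mathbf u(n)\|^2-\|\mathbf y(n)\|^2\right),$$ the infimum being over all $n_{-1}<0$ and all system trajectories $(\mathbf u(n),\mathbf x(n),\mathbf y(n))_{n\ge n_{-1}}$ with $\mathbf x(n_{-1})=0$ and $\mathbf x(0)=x_0$ (with $\inf\emptyset=+\infty$). Then: (1) $S_a$ is a storage function for $\Sigma$; (2) $S_r$ is a storage function for $\Sigma$; (3) for each storage function $S$ for $\Sigma$, $S_a(x_0)\le S(x_0)\le S_r(x_0)$ for all $x_0\in\mathcal X$.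
   Context: System: $\mathcal U,\mathcal X,\mathcal Y$ Hilbert spaces, $A:\mathcal X\to\mathcal X$, $B:\mathcal U\to\mathcal X$, $C:\mathcal X\to\mathcal Y$, $D:\mathcal U\to\mathcal Y$ bounded. A system trajectory $(\mathbf u(n),\mathbf x(n),\mathbf y(n))_{n\ge N_0}$ satisfies $\mathbf x(n+1)=A\mathbf x(n)+B\mathbf u(n)$, $\mathbf y(n)=C\mathbf x(n)+D\mathbf u(n)$ for all $n\ge N_0$ (inputs are arbitrary $\mathcal U$-valued sequences). Transfer function: $F_\Sigma(\lambda)=D+\lambda C(I-\lambda A)^{-1}B$ near $0$. $\mathcal S(\mathcal U,\mathcal Y)$: holomorphic $F:\mathbb D\to\mathcal L(\mathcal U,\mathcal Y)$ with $\|F(\lambda)\|\le1$ on $\mathbb D$. A storage function for $\Sigma$ is a function $S:\mathcal X\to[0,\infty]$ with $S(0)=0$ and $S(\mathbf x(n+1))\le S(\mathbf x(n))+\|\mathbf u(n)\|^2-\|\mathbf y(n)\|^2$ for all $n\ge N_0$, along all system trajectories $(\mathbf u(n),\mathbf x(n),\mathbf y(n))_{n\ge N_0}$ with $\mathbf x(N_0)=x_0$, for arbitrary $x_0\in\mathcal X$ and $N_0\in\mathbb Z$. *)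

theory Defs
  imports "HOL-Analysis.Analysis"
begin

text \<open>
  A complex Hilbert space is presented as a real Hilbert space together with a compatible complex
  structure: complex scalar multiplication extends the real one, and the real part of the complex
  inner product (linear in the first argument) is the real inner product. In particular
  norm, metric and topology are those of the complex inner product.
\<close>

class complex_hilbert_space = real_inner + complete_space +
  fixes scaleC :: "complex \<Rightarrow> 'a \<Rightarrow> 'a" (infixr \<open>*\<^sub>C\<close> 75)
    and cinner :: "'a \<Rightarrow> 'a \<Rightarrow> complex"
  assumes scaleC_add_right: "c *\<^sub>C (x + y) = c *\<^sub>C x + c *\<^sub>C y"
    and scaleC_add_left: "(c + d) *\<^sub>C x = c *\<^sub>C x + d *\<^sub>C x"
    and scaleC_scaleC: "c *\<^sub>C (d *\<^sub>C x) = (c * d) *\<^sub>C x"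
    and scaleC_of_real: "complex_of_real r *\<^sub>C x = r *\<^sub>R x"
    and cinner_add_left: "cinner (x + y) z = cinner x z + cinner y z"
    and cinner_scaleC_left: "cinner (c *\<^sub>C x) y = c * cinner x y"
    and cinner_commute: "cinner y x = cnj (cinner x y)"
    and Re_cinner: "Re (cinner x y) = inner x y"

instantiation complex :: complex_hilbert_space
begin

definition scaleC_complex :: "complex \<Rightarrow> complex \<Rightarrow> complex"
  where "scaleC_complex c x = c * x"

definition cinner_complex :: "complex \<Rightarrow> complex \<Rightarrow> complex"
  where "cinner_complex x y = x * cnj y"

instance
  by standard
    (simp_all add: scaleC_complex_def cinner_complex_def algebra_simps scaleR_conv_of_real
      inner_complex_def)

end

lemma norm_scaleC: "norm (c *\<^sub>C x) = cmod c * norm x" for x :: "'a::complex_hilbert_space"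
proof -
  have "cinner (c *\<^sub>C x) (c *\<^sub>C x) = c * cnj c * cinner x x"
    using cinner_commute[of x "c *\<^sub>C x"]
    by (simp add: cinner_scaleC_left mult.assoc) (metis cinner_commute)
  also have "\<dots> = complex_of_real ((cmod c)\<^sup>2) * cinner x x"
    by (simp only: complex_norm_square)
  finally have "inner (c *\<^sub>C x) (c *\<^sub>C x) = (cmod c)\<^sup>2 * inner x x"
    by (simp flip: Re_cinner)
  then have "(norm (c *\<^sub>C x))\<^sup>2 = (cmod c * norm x)\<^sup>2"
    by (simp add: power2_norm_eq_inner power_mult_distrib)
  then show ?thesis
    by simp
qed

lemma bounded_linear_scaleC: "bounded_linear (\<lambda>x::'a::complex_hilbert_space. c *\<^sub>C x)"
proof
  show "c *\<^sub>C (x + y) = c *\<^sub>C x + c *\<^sub>C y" for x y :: 'a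
    by (rule scaleC_add_right)
  show "c *\<^sub>C (r *\<^sub>R x) = r *\<^sub>R (c *\<^sub>C x)" for r and x :: 'a
    by (simp add: scaleC_scaleC mult.commute flip: scaleC_of_real)
  show "\<exists>K. \<forall>x::'a. norm (c *\<^sub>C x) \<le> norm x * K"
    by (auto simp: norm_scaleC mult.commute intro!: exI[of _ "cmod c"])
qed

text \<open>
  The type of bounded real-linear maps carries the operator norm, which for a complex-linear map is
  the usual one. A bounded operator between complex Hilbert spaces is an element of this type that is
  in addition complex-linear.
\<close>

definition clinear_blinfun ::
    "('a::complex_hilbert_space \<Rightarrow>\<^sub>L 'b::complex_hilbert_space) \<Rightarrow> bool"
  where "clinear_blinfun T \<longleftrightarrow>
    (\<forall>c x. blinfun_apply T (c *\<^sub>C x) = c *\<^sub>C blinfun_apply T x)"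

lift_definition cscale_blinfun ::
    "complex \<Rightarrow> ('a::real_normed_vector \<Rightarrow>\<^sub>L 'b::complex_hilbert_space) \<Rightarrow> 'a \<Rightarrow>\<^sub>L 'b"
  is "\<lambda>c f x. c *\<^sub>C f x"
  by (rule bounded_linear_compose[OF bounded_linear_scaleC])

text \<open>
  The two-sided inverse of an operator; only meaningful for boundedly invertible operators.
\<close>

definition blinfun_inverse ::
    "('a::real_normed_vector \<Rightarrow>\<^sub>L 'b::real_normed_vector) \<Rightarrow> 'b \<Rightarrow>\<^sub>L 'a"
  where "blinfun_inverse T = (THE R. R o\<^sub>L T = id_blinfun \<and> T o\<^sub>L R = id_blinfun)"

text \<open>
  Holomorphy of an operator-valued function: the complex difference quotients converge in
  operator norm.
\<close>

definition op_holomorphic_on ::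
    "(complex \<Rightarrow> 'a::complex_hilbert_space \<Rightarrow>\<^sub>L 'b::complex_hilbert_space)
      \<Rightarrow> complex set \<Rightarrow> bool" (infixl \<open>op'_holomorphic'_on\<close> 50)
  where "F op_holomorphic_on S \<longleftrightarrow>
    (\<forall>z\<in>S. \<exists>F'. ((\<lambda>w. cscale_blinfun (inverse (w - z)) (F w - F z)) \<longlongrightarrow> F') (at z within S))"

definition schur_class ::
    "(complex \<Rightarrow> 'u::complex_hilbert_space \<Rightarrow>\<^sub>L 'y::complex_hilbert_space) set"
  where "schur_class =
    {F. F op_holomorphic_on ball 0 1 \<and>
        (\<forall>z\<in>ball 0 1. clinear_blinfun (F z) \<and> norm (F z) \<le> 1)}"

definition transfer_function ::
    "('x::complex_hilbert_space \<Rightarrow>\<^sub>L 'x) \<Rightarrow> ('u::complex_hilbert_space \<Rightarrow>\<^sub>L 'x) \<Rightarrow>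
     ('x \<Rightarrow>\<^sub>L 'y::complex_hilbert_space) \<Rightarrow> ('u \<Rightarrow>\<^sub>L 'y) \<Rightarrow> complex \<Rightarrow> 'u \<Rightarrow>\<^sub>L 'y"
  where "transfer_function A B C D z =
    D + cscale_blinfun z (C o\<^sub>L blinfun_inverse (id_blinfun - cscale_blinfun z A) o\<^sub>L B)"

text \<open>
  Sequences indexed by the integers at least \<open>N\<close> are represented by total functions on
  the integers, of which only the values from \<open>N\<close> on are constrained.
\<close>

definition system_trajectory ::
    "('x::complex_hilbert_space \<Rightarrow>\<^sub>L 'x) \<Rightarrow> ('u::complex_hilbert_space \<Rightarrow>\<^sub>L 'x) \<Rightarrow>
     ('x \<Rightarrow>\<^sub>L 'y::complex_hilbert_space) \<Rightarrow> ('u \<Rightarrow>\<^sub>L 'y) \<Rightarrow>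
     int \<Rightarrow> (int \<Rightarrow> 'u) \<Rightarrow> (int \<Rightarrow> 'x) \<Rightarrow> (int \<Rightarrow> 'y) \<Rightarrow> bool"
  where "system_trajectory A B C D N u x y \<longleftrightarrow>
    (\<forall>n\<ge>N. x (n + 1) = blinfun_apply A (x n) + blinfun_apply B (u n) \<and>
            y n = blinfun_apply C (x n) + blinfun_apply D (u n))"

definition storage_function ::
    "('x::complex_hilbert_space \<Rightarrow>\<^sub>L 'x) \<Rightarrow> ('u::complex_hilbert_space \<Rightarrow>\<^sub>L 'x) \<Rightarrow>
     ('x \<Rightarrow>\<^sub>L 'y::complex_hilbert_space) \<Rightarrow> ('u \<Rightarrow>\<^sub>L 'y) \<Rightarrow> ('x \<Rightarrow> ereal) \<Rightarrow> bool"
  where "storage_function A B C D S \<longleftrightarrow>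
    (\<forall>x. 0 \<le> S x) \<and> S 0 = 0 \<and>
    (\<forall>N u x y. system_trajectory A B C D N u x y \<longrightarrow>
      (\<forall>n\<ge>N. S (x (n + 1)) \<le> S (x n) + ereal ((norm (u n))\<^sup>2 - (norm (y n))\<^sup>2)))"

definition available_storage ::
    "('x::complex_hilbert_space \<Rightarrow>\<^sub>L 'x) \<Rightarrow> ('u::complex_hilbert_space \<Rightarrow>\<^sub>L 'x) \<Rightarrow>
     ('x \<Rightarrow>\<^sub>L 'y::complex_hilbert_space) \<Rightarrow> ('u \<Rightarrow>\<^sub>L 'y) \<Rightarrow> 'x \<Rightarrow> ereal"
  where "available_storage A B C D x0 =
    Sup {ereal (\<Sum>n=0..n1. ((norm (y n))\<^sup>2 - (norm (u n))\<^sup>2)) | u x y n1.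
           0 \<le> n1 \<and> system_trajectory A B C D 0 u x y \<and> x 0 = x0}"

definition required_supply ::
    "('x::complex_hilbert_space \<Rightarrow>\<^sub>L 'x) \<Rightarrow> ('u::complex_hilbert_space \<Rightarrow>\<^sub>L 'x) \<Rightarrow>
     ('x \<Rightarrow>\<^sub>L 'y::complex_hilbert_space) \<Rightarrow> ('u \<Rightarrow>\<^sub>L 'y) \<Rightarrow> 'x \<Rightarrow> ereal"
  where "required_supply A B C D x0 =
    Inf {ereal (\<Sum>n=m..-1. ((norm (u n))\<^sup>2 - (norm (y n))\<^sup>2)) | u x y m.
           m < 0 \<and> system_trajectory A B C D m u x y \<and> x m = 0 \<and> x 0 = x0}"

end

theory Submission
  imports Defs "HOL-Complex_Analysis.Conformal_Mappings"
begin

text \<open>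
  Everything rests on one inequality, called \<open>dissipative_at_rest\<close> below: along a trajectory
  that starts in the state 0, the energy of the output up to any time is at most the energy of the
  input up to that time. It says that the available storage at 0 is at most 0 and that the required
  supply is nonnegative everywhere. All remaining claims are bookkeeping with trajectories. Placing
  one step of a trajectory in front of a competitor for the available storage gives its storage
  inequality, appending one step to a competitor for the required supply gives
  the one for the required supply, and summing the storage inequality of an arbitrary storage function
  along a competitor compares it with both (the lemmas \<open>available_storage_step\<close>,
  \<open>required_supply_step\<close> and \<open>storage_function_sum\<close>).

  The inequality (lemma \<open>schur_class_dissipative\<close>) is the fact that multiplication by a Schur
  function \<open>F\<close> is a contraction of the Hardy space. For an input polynomial
  \<open>p(z) = \<Sum>n\<le>N. z^n u(n)\<close> the first \<open>N + 1\<close> Taylor coefficients of \<open>F p\<close> are the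
  outputs \<open>y(0), \<dots>, y(N)\<close>. Let \<open>q(z) = \<Sum>n\<le>N. z^n y(n)\<close>. On the circle of radius
  \<open>r < 1\<close> one has \<open>2 Re \<langle>F p, q\<rangle> \<le> \<parallel>p\<parallel>\<^sup>2 + \<parallel>q\<parallel>\<^sup>2\<close>, and the three terms have the
  circle means \<open>2 \<Sum> r^(2n) \<parallel>y(n)\<parallel>\<^sup>2\<close>, \<open>\<Sum> r^(2n) \<parallel>u(n)\<parallel>\<^sup>2\<close> and
  \<open>\<Sum> r^(2n) \<parallel>y(n)\<parallel>\<^sup>2\<close>. It remains to let \<open>r\<close> tend to 1. Testing against the
  polynomial \<open>q\<close> means that only scalar functions \<open>\<langle>F p, v\<rangle>\<close> are ever integrated, so the
  classical Cauchy formula suffices.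
\<close>

section \<open>Complex Hilbert spaces\<close>

subclass (in complex_hilbert_space) banach ..

lemma cinner_zero_left [simp]: "cinner 0 y = 0"
  using cinner_add_left[of 0 0 y] by simp

lemma cinner_zero_right [simp]: "cinner y 0 = 0"
  by (metis cinner_commute cinner_zero_left complex_cnj_zero)

lemma cinner_add_right: "cinner x (y + z) = cinner x y + cinner x z"
  by (metis cinner_add_left cinner_commute complex_cnj_add)

lemma cinner_scaleC_right: "cinner x (c *\<^sub>C y) = cnj c * cinner x y"
  by (metis cinner_scaleC_left cinner_commute complex_cnj_mult)

lemma cinner_diff_left: "cinner (x - y) z = cinner x z - cinner y z"
  using cinner_add_left[of "x - y" y z] by simp

lemma cinner_sum_left: "cinner (\<Sum>i\<in>I. f i) y = (\<Sum>i\<in>I. cinner (f i) y)"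
  by (induction I rule: infinite_finite_induct) (auto simp: cinner_add_left)

lemma cinner_sum_right: "cinner y (\<Sum>i\<in>I. f i) = (\<Sum>i\<in>I. cinner y (f i))"
  by (induction I rule: infinite_finite_induct) (auto simp: cinner_add_right)

lemma norm_cinner_le: "norm (cinner x y) \<le> norm x * norm y"
proof (cases "cinner x y = 0")
  case False
  \<comment> \<open>Rotating \<open>x\<close> by a unimodular scalar makes the inner product real,
    hence equal to the real one.\<close>
  define c where "c = cnj (cinner x y) / cmod (cinner x y)"
  have "cmod c = 1"
    using False by (simp add: c_def norm_divide)
  have "c * cinner x y = complex_of_real (cmod (cinner x y))"
    using False complex_norm_square[of "cinner x y"]
    by (simp add: c_def field_simps power2_eq_square)
  then have "cmod (cinner x y) = Re (cinner (c *\<^sub>C x) y)"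
    by (simp add: cinner_scaleC_left)
  also have "\<dots> \<le> norm (c *\<^sub>C x) * norm y"
    by (simp add: Re_cinner norm_cauchy_schwarz)
  finally show ?thesis
    using \<open>cmod c = 1\<close> by (simp add: norm_scaleC)
qed simp

lemma bounded_linear_cinner_left: "bounded_linear (\<lambda>x. cinner x y)"
proof (rule bounded_linear_intro[where K = "norm y"])
  show "cinner (r *\<^sub>R x) y = r *\<^sub>R cinner x y" for r x
    by (simp add: cinner_scaleC_left scaleR_conv_of_real flip: scaleC_of_real)
qed (simp_all add: cinner_add_left norm_cinner_le)

lemma scaleC_diff_right: "c *\<^sub>C (x - y) = c *\<^sub>C x - c *\<^sub>C (y::'a::complex_hilbert_space)"
  using scaleC_add_right[of c "x - y" y] by simp

lemma scaleC_zero_right [simp]: "c *\<^sub>C (0::'a::complex_hilbert_space) = 0"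
  using scaleC_add_right[of c 0 "0::'a"] by simp

lemma scaleC_one [simp]: "1 *\<^sub>C x = (x::'a::complex_hilbert_space)"
  using scaleC_of_real[of 1 x] by simp

lemma blinfun_apply_sum: "blinfun_apply T (\<Sum>i\<in>I. f i) = (\<Sum>i\<in>I. blinfun_apply T (f i))"
  by (rule linear_sum) (rule bounded_linear.linear[OF blinfun.bounded_linear_right])

lemma clinear_blinfunD: "clinear_blinfun T \<Longrightarrow> blinfun_apply T (c *\<^sub>C x) = c *\<^sub>C blinfun_apply T x"
  by (simp add: clinear_blinfun_def)

lemma cscale_blinfun_apply: "blinfun_apply (cscale_blinfun c T) x = c *\<^sub>C blinfun_apply T x"
  by transfer simp

section \<open>Square sums of power series coefficients\<close>

text \<open>
  The parametrisation by \<open>{0..1}\<close> turns the measure \<open>dz / (2\<pi>iz)\<close> of Cauchy's formula into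
  Lebesgue measure, so contour integrals can be compared pointwise as ordinary integrals.
\<close>

lemma circle_mean_value:
  assumes "f holomorphic_on ball 0 1" "0 < r" "r < 1"
  shows "((\<lambda>t. f (circlepath 0 r t)) has_integral f 0) {0..1}"
proof -
  have "f holomorphic_on cball 0 r"
    using assms by (auto intro: holomorphic_on_subset)
  then have "((\<lambda>u. f u / (u - 0)) has_contour_integral (2 * of_real pi * \<i> * f 0)) (circlepath 0 r)"
    by (rule Cauchy_integral_circlepath_simple) (use assms in auto)
  then have "((\<lambda>t. f (circlepath 0 r t) / circlepath 0 r t *
      vector_derivative (circlepath 0 r) (at t)) has_integral 2 * of_real pi * \<i> * f 0) {0..1}"
    unfolding has_contour_integral by simp
  moreover have "f (circlepath 0 r t) / circlepath 0 r t * vector_derivative (circlepath 0 r) (at t)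
      = (2 * of_real pi * \<i>) * f (circlepath 0 r t)" for t
    using assms unfolding vector_derivative_circlepath by (simp add: circlepath field_simps)
  ultimately have "((\<lambda>t. (2 * of_real pi * \<i>) * f (circlepath 0 r t)) has_integral
      2 * of_real pi * \<i> * f 0) {0..1}"
    by simp
  from has_integral_mult_right[OF this, of "inverse (2 * of_real pi * \<i>)"] show ?thesis
    by (simp add: field_simps)
qed

lemma norm_circlepath_0: "0 \<le> r \<Longrightarrow> cmod (circlepath 0 r t) = r"
  by (simp add: circlepath norm_mult)

text \<open>
  Since \<open>z * cnj z = r\<^sup>2\<close> on the circle, a conjugate power cancels against a power of at least the
  same degree and leaves a holomorphic expression, to which the mean value property applies.
\<close>

lemma circle_power_cnj_power:
  assumes "0 < r" "n \<le> j"
  shows "circlepath 0 r t ^ j * cnj (circlepath 0 r t) ^ n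
    = complex_of_real (r ^ (2 * n)) * circlepath 0 r t ^ (j - n)"
proof -
  have *: "circlepath 0 r t * cnj (circlepath 0 r t) = complex_of_real (r ^ 2)"
    using assms by (metis complex_norm_square norm_circlepath_0 less_imp_le of_real_power)
  have "circlepath 0 r t ^ j = circlepath 0 r t ^ n * circlepath 0 r t ^ (j - n)"
    using assms by (simp flip: power_add)
  then have "circlepath 0 r t ^ j * cnj (circlepath 0 r t) ^ n
      = (circlepath 0 r t * cnj (circlepath 0 r t)) ^ n * circlepath 0 r t ^ (j - n)"
    by (simp add: power_mult_distrib mult_ac)
  then show ?thesis
    unfolding * by (simp add: power_mult)
qed

lemma circle_orthogonality:
  assumes "0 < r" "r < 1"
  shows "((\<lambda>t. circlepath 0 r t ^ j * cnj (circlepath 0 r t) ^ n) has_integral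
    (if j = n then complex_of_real (r ^ (2 * n)) else 0)) {0..1}"
proof -
  have le: "((\<lambda>t. circlepath 0 r t ^ j * cnj (circlepath 0 r t) ^ n) has_integral
      (if j = n then complex_of_real (r ^ (2 * n)) else 0)) {0..1}" if "n \<le> j" for j n
  proof -
    have "((\<lambda>t. complex_of_real (r ^ (2 * n)) * circlepath 0 r t ^ (j - n)) has_integral
        complex_of_real (r ^ (2 * n)) * 0 ^ (j - n)) {0..1}"
      using circle_mean_value[of "\<lambda>z. complex_of_real (r ^ (2 * n)) * z ^ (j - n)" r] assms
      by (force intro!: holomorphic_intros)
    moreover have "complex_of_real (r ^ (2 * n)) * 0 ^ (j - n) =
        (if j = n then complex_of_real (r ^ (2 * n)) else 0)"
      using that by (auto simp: power_0_left)
    ultimately show ?thesis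
      unfolding circle_power_cnj_power[OF assms(1) that] by simp
  qed
  show ?thesis
  proof (cases "n \<le> j")
    case False
    with le[of j n] have "((\<lambda>t. circlepath 0 r t ^ n * cnj (circlepath 0 r t) ^ j) has_integral 0) {0..1}"
      by simp
    then have "(cnj \<circ> (\<lambda>t. circlepath 0 r t ^ n * cnj (circlepath 0 r t) ^ j) has_integral cnj 0) {0..1}"
      unfolding has_integral_cnj .
    with False show ?thesis
      by (simp add: o_def mult.commute)
  qed (rule le)
qed

text \<open>
  The jet of order \<open>N\<close> at 0 is tested against each vector \<open>v\<close> separately, which keeps all
  holomorphic functions scalar. The point 0 is left out because remainders arise as
  quotients by \<open>z ^ Suc N\<close>; means over circles around 0 do not see it.
\<close>

definition weak_jet ::
    "nat \<Rightarrow> (complex \<Rightarrow> 'a::complex_hilbert_space) \<Rightarrow> (nat \<Rightarrow> 'a) \<Rightarrow> bool" where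
  "weak_jet N g a \<longleftrightarrow> (\<forall>v. \<exists>h. h holomorphic_on ball 0 1 \<and>
    (\<forall>z\<in>ball 0 1 - {0}. cinner (g z) v = (\<Sum>j\<le>N. cinner (a j) v * z ^ j) + z ^ Suc N * h z))"

lemma weak_jet_polynomial: "weak_jet N (\<lambda>z. \<Sum>j\<le>N. z ^ j *\<^sub>C a j) a"
  unfolding weak_jet_def
  by (intro allI exI[of _ "\<lambda>_. 0"]) (auto simp: cinner_sum_left cinner_scaleC_left mult.commute)

text \<open>
  Parseval's identity against a polynomial of degree \<open>N\<close>: the remainder of the jet carries the factor
  \<open>z ^ Suc N\<close>, which survives multiplication by \<open>cnj z ^ n\<close> for \<open>n \<le> N\<close> as a positive power
  of \<open>z\<close>, so it has circle mean 0.
\<close>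

lemma circle_mean_cinner:
  assumes "weak_jet N g a" "0 < r" "r < 1"
  shows "((\<lambda>t. cinner (g (circlepath 0 r t)) (\<Sum>n\<le>N. circlepath 0 r t ^ n *\<^sub>C v n)) has_integral
    (\<Sum>n\<le>N. complex_of_real (r ^ (2 * n)) * cinner (a n) (v n))) {0..1}"
proof -
  define \<gamma> where "\<gamma> = circlepath 0 r"
  have "\<exists>h. h holomorphic_on ball 0 1 \<and> (\<forall>z\<in>ball 0 1 - {0}. cinner (g z) (v n)
      = (\<Sum>j\<le>N. cinner (a j) (v n) * z ^ j) + z ^ Suc N * h z)" for n
    using assms(1) unfolding weak_jet_def by blast
  then obtain h where h: "\<And>n. h n holomorphic_on ball 0 1"
    and g: "\<And>n z. z \<in> ball 0 1 - {0} \<Longrightarrow> cinner (g z) (v n)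
      = (\<Sum>j\<le>N. cinner (a j) (v n) * z ^ j) + z ^ Suc N * h n z"
    by metis
  have \<gamma>: "\<gamma> t \<in> ball 0 1 - {0}" for t
    using assms norm_circlepath_0[of r t] by (auto simp: \<gamma>_def)
  have tail: "((\<lambda>t. \<gamma> t ^ Suc N * h n (\<gamma> t) * cnj (\<gamma> t) ^ n) has_integral 0) {0..1}"
    if "n \<le> N" for n
  proof -
    have "((\<lambda>t. complex_of_real (r ^ (2 * n)) * \<gamma> t ^ (Suc N - n) * h n (\<gamma> t)) has_integral
        complex_of_real (r ^ (2 * n)) * 0 ^ (Suc N - n) * h n 0) {0..1}"
      unfolding \<gamma>_def
      by (rule circle_mean_value[of "\<lambda>z. complex_of_real (r ^ (2 * n)) * z ^ (Suc N - n) * h n z"])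
        (use assms h in \<open>auto intro!: holomorphic_intros\<close>)
    moreover have "\<gamma> t ^ Suc N * h n (\<gamma> t) * cnj (\<gamma> t) ^ n
        = complex_of_real (r ^ (2 * n)) * \<gamma> t ^ (Suc N - n) * h n (\<gamma> t)" for t
    proof -
      have "\<gamma> t ^ Suc N * h n (\<gamma> t) * cnj (\<gamma> t) ^ n
          = (\<gamma> t ^ Suc N * cnj (\<gamma> t) ^ n) * h n (\<gamma> t)"
        by (simp only: ac_simps)
      then show ?thesis
        using circle_power_cnj_power[of r n "Suc N" t] assms(2) that by (simp only: \<gamma>_def le_SucI)
    qed
    ultimately show ?thesis
      using that by (simp only: power_0_left) (simp add: Suc_diff_le)
  qed
  have "((\<lambda>t. (\<Sum>n\<le>N. (\<Sum>j\<le>N. cinner (a j) (v n) * (\<gamma> t ^ j * cnj (\<gamma> t) ^ n))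
        + \<gamma> t ^ Suc N * h n (\<gamma> t) * cnj (\<gamma> t) ^ n))
      has_integral (\<Sum>n\<le>N. (\<Sum>j\<le>N. cinner (a j) (v n) *
        (if j = n then complex_of_real (r ^ (2 * n)) else 0)) + 0)) {0..1}"
    unfolding \<gamma>_def
    by (intro has_integral_sum has_integral_add has_integral_mult_right circle_orthogonality
        tail[unfolded \<gamma>_def] assms) auto
  moreover have "(\<Sum>n\<le>N. (\<Sum>j\<le>N. cinner (a j) (v n) * (\<gamma> t ^ j * cnj (\<gamma> t) ^ n))
        + \<gamma> t ^ Suc N * h n (\<gamma> t) * cnj (\<gamma> t) ^ n)
      = cinner (g (\<gamma> t)) (\<Sum>n\<le>N. \<gamma> t ^ n *\<^sub>C v n)" for t
    unfolding cinner_sum_right cinner_scaleC_right g[OF \<gamma>]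
    by (intro sum.cong) (auto simp: algebra_simps sum_distrib_left)
  moreover have "(\<Sum>n\<le>N. (\<Sum>j\<le>N. cinner (a j) (v n) *
        (if j = n then complex_of_real (r ^ (2 * n)) else 0)) + 0)
      = (\<Sum>n\<le>N. complex_of_real (r ^ (2 * n)) * cinner (a n) (v n))"
    by (intro sum.cong) (auto simp: if_distrib cong: if_cong)
  ultimately show ?thesis
    by (simp add: \<gamma>_def)
qed

text \<open>
  The mean of \<open>2 Re \<langle>g, q\<rangle> \<le> \<parallel>g\<parallel>\<^sup>2 + \<parallel>q\<parallel>\<^sup>2 \<le> \<parallel>p\<parallel>\<^sup>2 + \<parallel>q\<parallel>\<^sup>2\<close> over a circle, where \<open>q\<close> is the
  polynomial with the coefficients \<open>a\<close>, bounds twice a weighted square sum of \<open>a\<close> by itself plus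
  that of \<open>u\<close>. The function \<open>g\<close> itself is never integrated in norm.
\<close>

lemma weak_jet_square_sum_le:
  fixes g :: "complex \<Rightarrow> 'a::complex_hilbert_space" and u :: "nat \<Rightarrow> 'b::complex_hilbert_space"
  assumes "weak_jet N g a"
    and le: "\<And>z. z \<in> ball 0 1 \<Longrightarrow> norm (g z) \<le> norm (\<Sum>n\<le>N. z ^ n *\<^sub>C u n)"
  shows "(\<Sum>n\<le>N. (norm (a n))\<^sup>2) \<le> (\<Sum>n\<le>N. (norm (u n))\<^sup>2)"
proof -
  have radius: "(\<Sum>n\<le>N. r ^ (2 * n) * (norm (a n))\<^sup>2) \<le> (\<Sum>n\<le>N. r ^ (2 * n) * (norm (u n))\<^sup>2)"
    if r: "0 < r" "r < 1" for r
  proof -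
    define p where "p = (\<lambda>t. \<Sum>n\<le>N. circlepath 0 r t ^ n *\<^sub>C u n)"
    define q where "q = (\<lambda>t. \<Sum>n\<le>N. circlepath 0 r t ^ n *\<^sub>C a n)"
    have "((\<lambda>t. Re (cinner (g (circlepath 0 r t)) (q t))) has_integral
        Re (\<Sum>n\<le>N. complex_of_real (r ^ (2 * n)) * cinner (a n) (a n))) {0..1}"
      unfolding q_def by (intro has_integral_Re circle_mean_cinner assms r)
    then have gq: "((\<lambda>t. inner (g (circlepath 0 r t)) (q t)) has_integral
        (\<Sum>n\<le>N. r ^ (2 * n) * (norm (a n))\<^sup>2)) {0..1}"
      by (simp add: Re_cinner power2_norm_eq_inner)
    have "((\<lambda>t. Re (cinner (p t) (p t))) has_integral
        Re (\<Sum>n\<le>N. complex_of_real (r ^ (2 * n)) * cinner (u n) (u n))) {0..1}"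
      unfolding p_def by (intro has_integral_Re circle_mean_cinner weak_jet_polynomial r)
    then have pp: "((\<lambda>t. (norm (p t))\<^sup>2) has_integral
        (\<Sum>n\<le>N. r ^ (2 * n) * (norm (u n))\<^sup>2)) {0..1}"
      by (simp add: Re_cinner power2_norm_eq_inner)
    have "((\<lambda>t. Re (cinner (q t) (q t))) has_integral
        Re (\<Sum>n\<le>N. complex_of_real (r ^ (2 * n)) * cinner (a n) (a n))) {0..1}"
      unfolding q_def by (intro has_integral_Re circle_mean_cinner weak_jet_polynomial r)
    then have qq: "((\<lambda>t. (norm (q t))\<^sup>2) has_integral
        (\<Sum>n\<le>N. r ^ (2 * n) * (norm (a n))\<^sup>2)) {0..1}"
      by (simp add: Re_cinner power2_norm_eq_inner)
    have "2 * inner (g (circlepath 0 r t)) (q t) \<le> (norm (p t))\<^sup>2 + (norm (q t))\<^sup>2" for t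
    proof -
      have "circlepath 0 r t \<in> ball 0 1"
        using r norm_circlepath_0[of r t] by auto
      then have "(norm (g (circlepath 0 r t)))\<^sup>2 \<le> (norm (p t))\<^sup>2"
        using le unfolding p_def by (intro power_mono) auto
      moreover have "0 \<le> inner (g (circlepath 0 r t) - q t) (g (circlepath 0 r t) - q t)"
        by simp
      ultimately show ?thesis
        by (simp add: power2_norm_eq_inner inner_diff_left inner_diff_right inner_commute)
    qed
    then show ?thesis
      using has_integral_le[OF has_integral_mult_right[OF gq, of 2] has_integral_add[OF pp qq]]
      by simp
  qed
  show ?thesis
  proof (rule tendsto_le[where F = "at_left (1::real)"])
    show "((\<lambda>r. \<Sum>n\<le>N. r ^ (2 * n) * (norm (a n))\<^sup>2) \<longlongrightarrow> (\<Sum>n\<le>N. (norm (a n))\<^sup>2)) (at_left 1)"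
      by (auto intro!: tendsto_eq_intros)
    show "((\<lambda>r. \<Sum>n\<le>N. r ^ (2 * n) * (norm (u n))\<^sup>2) \<longlongrightarrow> (\<Sum>n\<le>N. (norm (u n))\<^sup>2)) (at_left 1)"
      by (auto intro!: tendsto_eq_intros)
    show "\<forall>\<^sub>F r in at_left (1::real). (\<Sum>n\<le>N. r ^ (2 * n) * (norm (a n))\<^sup>2)
        \<le> (\<Sum>n\<le>N. r ^ (2 * n) * (norm (u n))\<^sup>2)"
      using eventually_at_left_real[OF zero_less_one] by eventually_elim (auto intro: radius)
  qed simp
qed

section \<open>Dissipation of trajectories that start at rest\<close>

text \<open>
  Right and left inverses are the fixed points of the contractions \<open>R \<mapsto> 1 + T R\<close> and
  \<open>L \<mapsto> 1 + L T\<close> on the Banach space of operators; as usual the two inverses agree.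
\<close>

lemma blinfun_inverse_id_minus:
  fixes T :: "'a::banach \<Rightarrow>\<^sub>L 'a"
  assumes "norm T \<le> 1 / 2"
  shows "blinfun_inverse (id_blinfun - T) o\<^sub>L (id_blinfun - T) = id_blinfun"
    and "(id_blinfun - T) o\<^sub>L blinfun_inverse (id_blinfun - T) = id_blinfun"
    and "norm (blinfun_inverse (id_blinfun - T)) \<le> 2"
proof -
  have id_compose: "id_blinfun o\<^sub>L S = S" and compose_id: "S o\<^sub>L id_blinfun = S" for S :: "'a \<Rightarrow>\<^sub>L 'a"
    by (auto intro: blinfun_eqI)
  have half: "norm (S o\<^sub>L T) \<le> norm S / 2" "norm (T o\<^sub>L S) \<le> norm S / 2" for S
    using norm_blinfun_compose[of S T] norm_blinfun_compose[of T S]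
      mult_left_mono[OF assms norm_ge_zero[of S]] by (auto simp: mult.commute)
  have "\<exists>!R. id_blinfun + (T o\<^sub>L R) = R"
  proof (rule banach_fix_type[of "1/2"])
    have "dist (id_blinfun + (T o\<^sub>L R)) (id_blinfun + (T o\<^sub>L R')) \<le> 1 / 2 * dist R R'" for R R'
      using half(2)[of "R - R'"]
      by (simp add: dist_norm bounded_bilinear.diff_right[OF bounded_bilinear_blinfun_compose])
    then show "\<forall>R R'. dist (id_blinfun + (T o\<^sub>L R)) (id_blinfun + (T o\<^sub>L R')) \<le> 1 / 2 * dist R R'"
      by blast
  qed auto
  then obtain R where "id_blinfun + (T o\<^sub>L R) = R"
    by blast
  then have R: "(id_blinfun - T) o\<^sub>L R = id_blinfun"
    by (metis add_diff_cancel_right' bounded_bilinear.diff_left[OF bounded_bilinear_blinfun_compose]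
        id_compose)
  have "\<exists>!L. id_blinfun + (L o\<^sub>L T) = L"
  proof (rule banach_fix_type[of "1/2"])
    have "dist (id_blinfun + (L o\<^sub>L T)) (id_blinfun + (L' o\<^sub>L T)) \<le> 1 / 2 * dist L L'" for L L'
      using half(1)[of "L - L'"]
      by (simp add: dist_norm bounded_bilinear.diff_left[OF bounded_bilinear_blinfun_compose])
    then show "\<forall>L L'. dist (id_blinfun + (L o\<^sub>L T)) (id_blinfun + (L' o\<^sub>L T)) \<le> 1 / 2 * dist L L'"
      by blast
  qed auto
  then obtain L where "id_blinfun + (L o\<^sub>L T) = L"
    by blast
  then have L: "L o\<^sub>L (id_blinfun - T) = id_blinfun"
    by (metis add_diff_cancel_right' bounded_bilinear.diff_right[OF bounded_bilinear_blinfun_compose]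
        compose_id)
  have unique: "R' = L" if "(id_blinfun - T) o\<^sub>L R' = id_blinfun" for R'
  proof -
    have "(L o\<^sub>L (id_blinfun - T)) o\<^sub>L R' = L o\<^sub>L ((id_blinfun - T) o\<^sub>L R')"
      by (rule blinfun_eqI) simp
    then show ?thesis
      by (simp add: L that id_compose compose_id)
  qed
  \<comment> \<open>The defining description of the inverse is uniquely satisfied by \<open>R = L\<close>.\<close>
  have "blinfun_inverse (id_blinfun - T) = R"
    unfolding blinfun_inverse_def
    by (rule the_equality) (use R L unique in auto)
  then show "blinfun_inverse (id_blinfun - T) o\<^sub>L (id_blinfun - T) = id_blinfun"
    "(id_blinfun - T) o\<^sub>L blinfun_inverse (id_blinfun - T) = id_blinfun"
    using R L unique[OF R] by auto
  have "norm R \<le> norm (id_blinfun :: 'a \<Rightarrow>\<^sub>L 'a) + norm (T o\<^sub>L R)"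
    by (metis \<open>id_blinfun + (T o\<^sub>L R) = R\<close> norm_triangle_ineq)
  moreover have "norm (id_blinfun :: 'a \<Rightarrow>\<^sub>L 'a) \<le> 1"
    by (rule norm_blinfun_bound) auto
  ultimately have "norm R \<le> 2"
    using half(2)[of R] by simp
  then show "norm (blinfun_inverse (id_blinfun - T)) \<le> 2"
    by (simp add: \<open>blinfun_inverse (id_blinfun - T) = R\<close>)
qed

lemma clinear_resolvent_apply:
  fixes A :: "'x::complex_hilbert_space \<Rightarrow>\<^sub>L 'x"
  assumes A: "clinear_blinfun A" and z: "norm (cscale_blinfun z A) \<le> 1 / 2"
  shows "blinfun_inverse (id_blinfun - cscale_blinfun z A) (c *\<^sub>C x)
    = c *\<^sub>C blinfun_inverse (id_blinfun - cscale_blinfun z A) x"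
proof -
  define T where "T = id_blinfun - cscale_blinfun z A"
  define R where "R = blinfun_inverse T"
  have RT: "R (T y) = y" and TR: "T (R y) = y" for y
    using blinfun_inverse_id_minus(1,2)[OF z] unfolding T_def[symmetric] R_def[symmetric]
    by (metis blinfun_apply_blinfun_compose blinfun_apply_id_blinfun id_apply)+
  have "T (c *\<^sub>C R x) = c *\<^sub>C T (R x)"
    using clinear_blinfunD[OF A]
    by (simp add: T_def blinfun.diff_left cscale_blinfun_apply scaleC_diff_right scaleC_scaleC
        mult.commute)
  then have "T (c *\<^sub>C R x) = c *\<^sub>C x"
    by (simp add: TR)
  then show ?thesis
    using RT unfolding R_def T_def by metis
qed

text \<open>
  The recursion \<open>x(n+1) = A x(n) + B u(n)\<close> summed against \<open>z^(n+1)\<close>. Truncation at \<open>N\<close>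
  leaves only the boundary term at \<open>N + 1\<close>, since \<open>x(0) = 0\<close>.
\<close>

lemma generating_polynomial_state:
  fixes A :: "'x::complex_hilbert_space \<Rightarrow>\<^sub>L 'x" and B :: "'u::complex_hilbert_space \<Rightarrow>\<^sub>L 'x"
  assumes "clinear_blinfun A" "clinear_blinfun B"
    and "x 0 = 0" "\<And>n. x (Suc n) = A (x n) + B (u n)"
  shows "(id_blinfun - cscale_blinfun z A) (\<Sum>n\<le>N. z ^ n *\<^sub>C x n)
    = z *\<^sub>C B (\<Sum>n\<le>N. z ^ n *\<^sub>C u n) - z ^ Suc N *\<^sub>C x (Suc N)"
proof (induction N)
  case 0
  then show ?case
    using assms(3) by (simp add: assms(4))
next
  case (Suc N)
  have "(id_blinfun - cscale_blinfun z A) (z ^ Suc N *\<^sub>C x (Suc N))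
      = z ^ Suc N *\<^sub>C x (Suc N) - z ^ Suc (Suc N) *\<^sub>C A (x (Suc N))"
    by (simp add: blinfun.diff_left cscale_blinfun_apply clinear_blinfunD[OF assms(1)] scaleC_scaleC
        mult.assoc)
  also have "A (x (Suc N)) = x (Suc (Suc N)) - B (u (Suc N))"
    by (simp add: assms(4)[of "Suc N"])
  also have "z ^ Suc N *\<^sub>C x (Suc N) - z ^ Suc (Suc N) *\<^sub>C (x (Suc (Suc N)) - B (u (Suc N)))
      = z ^ Suc N *\<^sub>C x (Suc N) - z ^ Suc (Suc N) *\<^sub>C x (Suc (Suc N))
        + z *\<^sub>C B (z ^ Suc N *\<^sub>C u (Suc N))"
    by (simp add: scaleC_diff_right scaleC_scaleC clinear_blinfunD[OF assms(2)] mult.assoc)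
  finally show ?case
    unfolding sum.atMost_Suc blinfun.add_right scaleC_add_right Suc by (simp add: algebra_simps)
qed

text \<open>
  Solving the previous identity for the state polynomial shows that the transfer function maps the
  input polynomial to the output polynomial, up to an error of order \<open>N + 1\<close> in \<open>z\<close>.
\<close>

lemma transfer_function_apply_polynomial:
  fixes A :: "'x::complex_hilbert_space \<Rightarrow>\<^sub>L 'x" and B :: "'u::complex_hilbert_space \<Rightarrow>\<^sub>L 'x"
    and C :: "'x \<Rightarrow>\<^sub>L 'y::complex_hilbert_space" and D :: "'u \<Rightarrow>\<^sub>L 'y"
  assumes lin: "clinear_blinfun A" "clinear_blinfun B" "clinear_blinfun C" "clinear_blinfun D"
    and traj: "x 0 = 0" "\<And>n. x (Suc n) = A (x n) + B (u n)" "\<And>n. y n = C (x n) + D (u n)"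
    and z: "norm (cscale_blinfun z A) \<le> 1 / 2"
  shows "transfer_function A B C D z (\<Sum>n\<le>N. z ^ n *\<^sub>C u n) = (\<Sum>n\<le>N. z ^ n *\<^sub>C y n)
    + z ^ Suc N *\<^sub>C C (blinfun_inverse (id_blinfun - cscale_blinfun z A) (x (Suc N)))"
proof -
  define R where "R = blinfun_inverse (id_blinfun - cscale_blinfun z A)"
  define p where "p = (\<Sum>n\<le>N. z ^ n *\<^sub>C u n)"
  have "(\<Sum>n\<le>N. z ^ n *\<^sub>C x n) = (R o\<^sub>L (id_blinfun - cscale_blinfun z A)) (\<Sum>n\<le>N. z ^ n *\<^sub>C x n)"
    using blinfun_inverse_id_minus(1)[OF z] by (simp add: R_def)
  also have "\<dots> = R (z *\<^sub>C B p - z ^ Suc N *\<^sub>C x (Suc N))"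
    using generating_polynomial_state[where x = x and u = u, OF lin(1,2) traj(1,2)]
    by (simp add: p_def)
  also have "\<dots> = z *\<^sub>C R (B p) - z ^ Suc N *\<^sub>C R (x (Suc N))"
    by (simp only: R_def blinfun.diff_right clinear_resolvent_apply[OF lin(1) z])
  finally have "z *\<^sub>C R (B p) = (\<Sum>n\<le>N. z ^ n *\<^sub>C x n) + z ^ Suc N *\<^sub>C R (x (Suc N))"
    by simp
  then have "C (z *\<^sub>C R (B p)) = (\<Sum>n\<le>N. z ^ n *\<^sub>C C (x n)) + z ^ Suc N *\<^sub>C C (R (x (Suc N)))"
    by (simp only: blinfun.add_right blinfun_apply_sum clinear_blinfunD[OF lin(3)])
  moreover have "transfer_function A B C D z p = D p + C (z *\<^sub>C R (B p))"
    by (simp add: transfer_function_def R_def blinfun.add_left cscale_blinfun_apply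
        clinear_blinfunD[OF lin(3)])
  moreover have "D p = (\<Sum>n\<le>N. z ^ n *\<^sub>C D (u n))"
    unfolding p_def by (simp only: blinfun_apply_sum clinear_blinfunD[OF lin(4)])
  moreover have "(\<Sum>n\<le>N. z ^ n *\<^sub>C y n) = (\<Sum>n\<le>N. z ^ n *\<^sub>C C (x n)) + (\<Sum>n\<le>N. z ^ n *\<^sub>C D (u n))"
    by (simp add: traj(3) scaleC_add_right sum.distrib)
  ultimately show ?thesis
    by (simp add: p_def R_def)
qed

lemma op_holomorphic_on_imp_weak:
  fixes F :: "complex \<Rightarrow> 'a::complex_hilbert_space \<Rightarrow>\<^sub>L 'b::complex_hilbert_space"
  assumes "F op_holomorphic_on S"
  shows "(\<lambda>z. cinner (F z u) v) holomorphic_on S"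
  unfolding holomorphic_on_def field_differentiable_def
proof
  fix z assume "z \<in> S"
  then obtain F' where F': "((\<lambda>w. cscale_blinfun (inverse (w - z)) (F w - F z)) \<longlongrightarrow> F') (at z within S)"
    using assms unfolding op_holomorphic_on_def by blast
  have "bounded_linear (\<lambda>T :: 'a \<Rightarrow>\<^sub>L 'b. cinner (T u) v)"
    by (rule bounded_linear_compose[OF bounded_linear_cinner_left blinfun.bounded_linear_left])
  from bounded_linear.tendsto[OF this F']
  have "((\<lambda>w. (cinner (F w u) v - cinner (F z u) v) / (w - z)) \<longlongrightarrow> cinner (F' u) v) (at z within S)"
    by (simp add: cscale_blinfun_apply cinner_scaleC_left blinfun.diff_left cinner_diff_left
        divide_inverse mult.commute)
  then show "\<exists>f'. ((\<lambda>z. cinner (F z u) v) has_field_derivative f') (at z within S)"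
    unfolding has_field_derivative_iff by blast
qed

text \<open>
  The outputs are the Taylor coefficients of \<open>F p\<close>. Near 0 this is
  \<open>transfer_function_apply_polynomial\<close>, whose error term divided by \<open>z ^ Suc N\<close> is bounded
  because the resolvent is; by Riemann's theorem on removable singularities the quotient extends to
  a holomorphic function on the whole disc, which is the remainder required of a jet.
\<close>

lemma weak_jet_of_response:
  fixes A :: "'x::complex_hilbert_space \<Rightarrow>\<^sub>L 'x" and B :: "'u::complex_hilbert_space \<Rightarrow>\<^sub>L 'x"
    and C :: "'x \<Rightarrow>\<^sub>L 'y::complex_hilbert_space" and D :: "'u \<Rightarrow>\<^sub>L 'y"
  assumes lin: "clinear_blinfun A" "clinear_blinfun B" "clinear_blinfun C" "clinear_blinfun D"
    and F: "F op_holomorphic_on ball 0 1" "\<And>z. z \<in> ball 0 1 \<Longrightarrow> clinear_blinfun (F z)"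
    and F_eq: "\<forall>\<^sub>F z in nhds 0. F z = transfer_function A B C D z"
    and traj: "x 0 = 0" "\<And>n. x (Suc n) = A (x n) + B (u n)" "\<And>n. y n = C (x n) + D (u n)"
  shows "weak_jet N (\<lambda>z. F z (\<Sum>n\<le>N. z ^ n *\<^sub>C u n)) y"
  unfolding weak_jet_def
proof
  fix v
  define f where "f z = cinner (F z (\<Sum>n\<le>N. z ^ n *\<^sub>C u n)) v - (\<Sum>j\<le>N. cinner (y j) v * z ^ j)" for z
  have "(\<lambda>z. (\<Sum>n\<le>N. z ^ n * cinner (F z (u n)) v) - (\<Sum>j\<le>N. cinner (y j) v * z ^ j))
      holomorphic_on ball 0 1"
    by (intro holomorphic_intros op_holomorphic_on_imp_weak F)
  moreover have "(\<Sum>n\<le>N. z ^ n * cinner (F z (u n)) v) - (\<Sum>j\<le>N. cinner (y j) v * z ^ j) = f z"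
    if "z \<in> ball 0 1" for z
    unfolding f_def blinfun_apply_sum clinear_blinfunD[OF F(2)[OF that]] cinner_sum_left
      cinner_scaleC_left by simp
  ultimately have "f holomorphic_on ball 0 1"
    by (metis (no_types, lifting) holomorphic_cong)
  then have hol: "(\<lambda>z. f z / z ^ Suc N) holomorphic_on (ball 0 1 - {0})"
    by (intro holomorphic_intros) (auto intro: holomorphic_on_subset)
  have "((\<lambda>z. cmod z * norm A) \<longlongrightarrow> 0) (nhds 0)"
    by (rule tendsto_eq_intros tendsto_norm filterlim_ident | simp)+
  then have "\<forall>\<^sub>F z in nhds 0. cmod z * norm A < 1 / 2"
    by (rule order_tendstoD) simp
  with F_eq have "\<forall>\<^sub>F z in nhds 0. z \<noteq> 0 \<longrightarrow>
      cmod (f z / z ^ Suc N) \<le> norm C * (2 * norm (x (Suc N))) * norm v"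
  proof eventually_elim
    case (elim z)
    define R where "R = blinfun_inverse (id_blinfun - cscale_blinfun z A)"
    have "norm (cscale_blinfun z A) \<le> cmod z * norm A"
      by (rule norm_blinfun_bound)
        (auto simp: cscale_blinfun_apply norm_scaleC mult.assoc intro!: mult_left_mono norm_blinfun)
    with elim have half: "norm (cscale_blinfun z A) \<le> 1 / 2"
      by simp
    have "f z = z ^ Suc N * cinner (C (R (x (Suc N)))) v"
      unfolding f_def elim transfer_function_apply_polynomial[where x = x, OF lin traj half]
      by (simp add: cinner_add_left cinner_sum_left cinner_scaleC_left R_def mult.commute)
    moreover have "cmod (cinner (C (R (x (Suc N)))) v) \<le> norm C * (2 * norm (x (Suc N))) * norm v"
    proof -
      have "norm (R (x (Suc N))) \<le> 2 * norm (x (Suc N))"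
        using norm_blinfun[of R "x (Suc N)"] blinfun_inverse_id_minus(3)[OF half]
        unfolding R_def by (meson mult_right_mono norm_ge_zero order_trans)
      then have "norm (C (R (x (Suc N)))) \<le> norm C * (2 * norm (x (Suc N)))"
        using norm_blinfun[of C "R (x (Suc N))"] by (meson mult_left_mono norm_ge_zero order_trans)
      then show ?thesis
        using norm_cinner_le by (meson mult_right_mono norm_ge_zero order_trans)
    qed
    ultimately show ?case
      by simp
  qed
  then have "\<exists>K. \<forall>\<^sub>F z in at 0. cmod (f z / z ^ Suc N) \<le> K"
    unfolding at_within_def by (auto simp: eventually_inf_principal elim: eventually_mono)
  then obtain h where h: "h holomorphic_on ball 0 1" "\<forall>z\<in>ball 0 1 - {0}. h z = f z / z ^ Suc N"
    using holomorphic_on_extend_bounded[OF hol] by auto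
  have "cinner (F z (\<Sum>n\<le>N. z ^ n *\<^sub>C u n)) v
      = (\<Sum>j\<le>N. cinner (y j) v * z ^ j) + z ^ Suc N * h z" if "z \<in> ball 0 1 - {0}" for z
    using h(2) that by (simp add: f_def)
  with h(1) show "\<exists>h. h holomorphic_on ball 0 1 \<and> (\<forall>z\<in>ball 0 1 - {0}.
      cinner (F z (\<Sum>n\<le>N. z ^ n *\<^sub>C u n)) v = (\<Sum>j\<le>N. cinner (y j) v * z ^ j) + z ^ Suc N * h z)"
    by blast
qed

text \<open>
  The Schur bound says that \<open>F p\<close> is pointwise no larger than \<open>p\<close>, while their
  coefficients up to \<open>N\<close> are the outputs and the inputs.
\<close>

lemma schur_class_dissipative:
  fixes A :: "'x::complex_hilbert_space \<Rightarrow>\<^sub>L 'x" and B :: "'u::complex_hilbert_space \<Rightarrow>\<^sub>L 'x"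
    and C :: "'x \<Rightarrow>\<^sub>L 'y::complex_hilbert_space" and D :: "'u \<Rightarrow>\<^sub>L 'y"
  assumes lin: "clinear_blinfun A" "clinear_blinfun B" "clinear_blinfun C" "clinear_blinfun D"
    and "F \<in> schur_class" "\<forall>\<^sub>F z in nhds 0. F z = transfer_function A B C D z"
    and traj: "x 0 = 0" "\<And>n. x (Suc n) = A (x n) + B (u n)" "\<And>n. y n = C (x n) + D (u n)"
  shows "(\<Sum>n\<le>N. (norm (y n))\<^sup>2) \<le> (\<Sum>n\<le>N. (norm (u n))\<^sup>2)"
proof (rule weak_jet_square_sum_le)
  show "weak_jet N (\<lambda>z. F z (\<Sum>n\<le>N. z ^ n *\<^sub>C u n)) y"
    by (rule weak_jet_of_response[where x = x, OF lin _ _ assms(6) traj])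
      (use assms(5) in \<open>auto simp: schur_class_def\<close>)
  show "norm (F z (\<Sum>n\<le>N. z ^ n *\<^sub>C u n)) \<le> norm (\<Sum>n\<le>N. z ^ n *\<^sub>C u n)" if "z \<in> ball 0 1" for z
  proof -
    have "norm (F z) \<le> 1"
      using that assms(5) by (auto simp: schur_class_def)
    then show ?thesis
      using norm_blinfun[of "F z"] by (meson mult_left_le_one_le norm_ge_zero order_trans)
  qed
qed

section \<open>Extremal storage functions\<close>

lemma sum_int_shift: "(\<Sum>k = i..j. f (k + d)) = (\<Sum>k = i + d..j + d. f k)" for i j d :: int
  by (rule sum.reindex_bij_witness[of _ "\<lambda>k. k - d" "\<lambda>k. k + d"]) auto

lemma sum_int_split_last: "i \<le> j + 1 \<Longrightarrow> (\<Sum>k = i..j + 1. f k) = (\<Sum>k = i..j. f k) + f (j + 1)"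
  for i j :: int and f :: "int \<Rightarrow> real"
proof -
  assume "i \<le> j + 1"
  then have "{i..j + 1} = insert (j + 1) {i..j}"
    by auto
  then show ?thesis
    by simp
qed

lemma sum_int_split_first: "i \<le> j \<Longrightarrow> (\<Sum>k = i..j. f k) = f i + (\<Sum>k = i + 1..j. f k)"
  for i j :: int and f :: "int \<Rightarrow> real"
proof -
  assume "i \<le> j"
  then have "{i..j} = insert i {i + 1..j}"
    by auto
  then show ?thesis
    by simp
qed

text \<open>
  Finite terms can be moved across an inequality even when the storage values are infinite.
\<close>

lemma ereal_add_le_iff: "X + ereal r \<le> Y \<longleftrightarrow> X \<le> Y + ereal (- r)"
  by (cases X; cases Y) auto

lemma system_trajectoryD:
  assumes "system_trajectory A B C D N u x y" "N \<le> n"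
  shows "x (n + 1) = blinfun_apply A (x n) + blinfun_apply B (u n)"
    and "y n = blinfun_apply C (x n) + blinfun_apply D (u n)"
  using assms unfolding system_trajectory_def by blast+

lemma available_storage_upper:
  assumes "system_trajectory A B C D 0 u x y" "0 \<le> n1"
  shows "ereal (\<Sum>n=0..n1. (norm (y n))\<^sup>2 - (norm (u n))\<^sup>2) \<le> available_storage A B C D (x 0)"
  unfolding available_storage_def using assms by (intro Sup_upper) blast

lemma available_storage_least:
  assumes "\<And>u x y n1. \<lbrakk>system_trajectory A B C D 0 u x y; 0 \<le> n1; x 0 = x0\<rbrakk> \<Longrightarrow>
    ereal (\<Sum>n=0..n1. (norm (y n))\<^sup>2 - (norm (u n))\<^sup>2) \<le> X"
  shows "available_storage A B C D x0 \<le> X"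
  unfolding available_storage_def using assms by (intro Sup_least) blast

lemma required_supply_lower:
  assumes "system_trajectory A B C D m u x y" "m < 0" "x m = 0"
  shows "required_supply A B C D (x 0) \<le> ereal (\<Sum>n=m..-1. (norm (u n))\<^sup>2 - (norm (y n))\<^sup>2)"
  unfolding required_supply_def using assms by (intro Inf_lower) blast

lemma required_supply_greatest:
  assumes "\<And>u x y m. \<lbrakk>system_trajectory A B C D m u x y; m < 0; x m = 0; x 0 = x0\<rbrakk> \<Longrightarrow>
    X \<le> ereal (\<Sum>n=m..-1. (norm (u n))\<^sup>2 - (norm (y n))\<^sup>2)"
  shows "X \<le> required_supply A B C D x0"
  unfolding required_supply_def using assms by (intro Inf_greatest) blast

lemma storage_function_sum:
  assumes S: "storage_function A B C D S" and traj: "system_trajectory A B C D m u x y"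
    and "m \<le> j + 1"
  shows "S (x (j + 1)) \<le> S (x m) + ereal (\<Sum>n=m..j. (norm (u n))\<^sup>2 - (norm (y n))\<^sup>2)"
proof -
  have "S (x k) \<le> S (x m) + ereal (\<Sum>n=m..k - 1. (norm (u n))\<^sup>2 - (norm (y n))\<^sup>2)" if "m \<le> k" for k
    using that
  proof (induction k rule: int_ge_induct)
    case (step k)
    have "S (x (k + 1)) \<le> S (x k) + ereal ((norm (u k))\<^sup>2 - (norm (y k))\<^sup>2)"
      using S traj step(1) unfolding storage_function_def by blast
    also have "\<dots> \<le> S (x m) + ereal (\<Sum>n=m..k - 1. (norm (u n))\<^sup>2 - (norm (y n))\<^sup>2)
        + ereal ((norm (u k))\<^sup>2 - (norm (y k))\<^sup>2)"
      by (intro add_right_mono step)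
    finally show ?case
      using sum_int_split_last[of m "k - 1" "\<lambda>n. (norm (u n))\<^sup>2 - (norm (y n))\<^sup>2"] step(1)
      by (simp add: add.assoc)
  qed simp
  from this[OF assms(3)] show ?thesis
    by simp
qed

lemma available_storage_le:
  assumes S: "storage_function A B C D S"
  shows "available_storage A B C D x0 \<le> S x0"
proof (rule available_storage_least)
  fix u x y and n1 :: int
  assume "system_trajectory A B C D 0 u x y" "0 \<le> n1" "x 0 = x0"
  with storage_function_sum[OF S, of 0 u x y n1]
  have "S (x (n1 + 1)) \<le> S x0 + ereal (\<Sum>n=0..n1. (norm (u n))\<^sup>2 - (norm (y n))\<^sup>2)"
    by simp
  moreover have "0 \<le> S (x (n1 + 1))"
    using S by (simp add: storage_function_def)
  ultimately have "0 \<le> S x0 + ereal (- (\<Sum>n=0..n1. (norm (y n))\<^sup>2 - (norm (u n))\<^sup>2))"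
    by (simp flip: sum_negf)
  then show "ereal (\<Sum>n=0..n1. (norm (y n))\<^sup>2 - (norm (u n))\<^sup>2) \<le> S x0"
    unfolding ereal_add_le_iff[symmetric] by simp
qed

lemma storage_le_required_supply:
  assumes S: "storage_function A B C D S"
  shows "S x0 \<le> required_supply A B C D x0"
proof (rule required_supply_greatest)
  fix u x y and m :: int
  assume "system_trajectory A B C D m u x y" "m < 0" "x m = 0" "x 0 = x0"
  with storage_function_sum[OF S, of m u x y "- 1"] S
  show "S x0 \<le> ereal (\<Sum>n=m..-1. (norm (u n))\<^sup>2 - (norm (y n))\<^sup>2)"
    by (simp add: storage_function_def)
qed

definition dissipative_at_rest ::
    "('x::complex_hilbert_space \<Rightarrow>\<^sub>L 'x) \<Rightarrow> ('u::complex_hilbert_space \<Rightarrow>\<^sub>L 'x) \<Rightarrow>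
     ('x \<Rightarrow>\<^sub>L 'y::complex_hilbert_space) \<Rightarrow> ('u \<Rightarrow>\<^sub>L 'y) \<Rightarrow> bool"
  where "dissipative_at_rest A B C D \<longleftrightarrow>
    (\<forall>m j u x y. system_trajectory A B C D m u x y \<longrightarrow> x m = 0 \<longrightarrow>
      0 \<le> (\<Sum>n=m..j. (norm (u n))\<^sup>2 - (norm (y n))\<^sup>2))"

lemma schur_class_dissipative_at_rest:
  fixes A :: "'x::complex_hilbert_space \<Rightarrow>\<^sub>L 'x" and B :: "'u::complex_hilbert_space \<Rightarrow>\<^sub>L 'x"
    and C :: "'x \<Rightarrow>\<^sub>L 'y::complex_hilbert_space" and D :: "'u \<Rightarrow>\<^sub>L 'y"
  assumes "clinear_blinfun A" "clinear_blinfun B" "clinear_blinfun C" "clinear_blinfun D"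
    and "F \<in> schur_class" "\<forall>\<^sub>F z in nhds 0. F z = transfer_function A B C D z"
  shows "dissipative_at_rest A B C D"
  unfolding dissipative_at_rest_def
proof (intro allI impI)
  fix m j :: int and u x y
  assume traj: "system_trajectory A B C D m u x y" and "x m = 0"
  show "0 \<le> (\<Sum>n=m..j. (norm (u n))\<^sup>2 - (norm (y n))\<^sup>2)"
  proof (cases "m \<le> j")
    case True
    define N where "N = nat (j - m)"
    have "(\<Sum>n\<le>N. (norm (y (m + int n)))\<^sup>2) \<le> (\<Sum>n\<le>N. (norm (u (m + int n)))\<^sup>2)"
    proof (rule schur_class_dissipative[OF assms, where x = "\<lambda>n. x (m + int n)"])
      show "x (m + int (Suc n)) = A (x (m + int n)) + B (u (m + int n))" for n
        using traj by (simp add: system_trajectory_def add.assoc[symmetric] add.commute[of 1])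
      show "y (m + int n) = C (x (m + int n)) + D (u (m + int n))" for n
        using traj by (simp add: system_trajectory_def)
    qed (simp add: \<open>x m = 0\<close>)
    moreover have "(\<Sum>n=m..j. (norm (u n))\<^sup>2 - (norm (y n))\<^sup>2)
        = (\<Sum>n\<le>N. (norm (u (m + int n)))\<^sup>2 - (norm (y (m + int n)))\<^sup>2)"
      by (rule sum.reindex_bij_witness[of _ "\<lambda>n. m + int n" "\<lambda>k. nat (k - m)"])
        (use True in \<open>auto simp: N_def\<close>)
    ultimately show ?thesis
      by (simp add: sum_subtractf)
  qed simp
qed

lemma trajectory_with_zero_input_exists:
  "\<exists>x y. system_trajectory A B C D N (\<lambda>_. 0) x y \<and> x N = x0"
proof -
  define x where "x k = (blinfun_apply A ^^ nat (k - N)) x0" for k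
  have "x (n + 1) = A (x n)" if "N \<le> n" for n
  proof -
    have "nat (n + 1 - N) = Suc (nat (n - N))"
      using that by simp
    then show ?thesis
      by (simp add: x_def)
  qed
  then have "system_trajectory A B C D N (\<lambda>_. 0) x (\<lambda>n. C (x n))"
    by (simp add: system_trajectory_def)
  moreover have "x N = x0"
    by (simp add: x_def)
  ultimately show ?thesis
    by blast
qed

text \<open>
  The zero input extracts \<open>\<parallel>y(0)\<parallel>\<^sup>2\<close> in one step, which is already a nonnegative
  amount.
\<close>

lemma available_storage_nonneg: "0 \<le> available_storage A B C D x0"
proof -
  obtain x y where traj: "system_trajectory A B C D 0 (\<lambda>_. 0) x y" and x0: "x 0 = x0"
    using trajectory_with_zero_input_exists by blast
  have "0 \<le> ereal (\<Sum>n=0..0::int. (norm (y n))\<^sup>2 - (norm (0::'b))\<^sup>2)"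
    by simp
  also have "\<dots> \<le> available_storage A B C D (x 0)"
    by (rule available_storage_upper[OF traj]) simp
  finally show ?thesis
    by (simp add: x0)
qed

text \<open>
  A competitor from the state \<open>x(n+1)\<close>, delayed by one time unit and preceded by the step from
  \<open>x(n)\<close> to \<open>x(n+1)\<close>, is a competitor from \<open>x(n)\<close>.
\<close>

lemma available_storage_step:
  assumes traj: "system_trajectory A B C D N u x y" and "N \<le> n"
  shows "available_storage A B C D (x (n + 1))
    \<le> available_storage A B C D (x n) + ereal ((norm (u n))\<^sup>2 - (norm (y n))\<^sup>2)"
proof (rule available_storage_least)
  fix u' x' y' and n1 :: int
  assume traj': "system_trajectory A B C D 0 u' x' y'" and "0 \<le> n1" and x': "x' 0 = x (n + 1)"
  define u'' where "u'' k = (if k = 0 then u n else u' (k - 1))" for k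
  define x'' where "x'' k = (if k = 0 then x n else x' (k - 1))" for k
  define y'' where "y'' k = (if k = 0 then y n else y' (k - 1))" for k
  have eqs: "x (n + 1) = A (x n) + B (u n)" "y n = C (x n) + D (u n)"
    using system_trajectoryD[OF traj \<open>N \<le> n\<close>] by simp_all
  have eqs': "x' (k - 1 + 1) = A (x' (k - 1)) + B (u' (k - 1))"
    "y' (k - 1) = C (x' (k - 1)) + D (u' (k - 1))" if "1 \<le> k" for k
    using system_trajectoryD[OF traj', of "k - 1"] that by simp_all
  have "system_trajectory A B C D 0 u'' x'' y''"
    unfolding system_trajectory_def
  proof (intro allI impI)
    fix k :: int assume "0 \<le> k"
    show "x'' (k + 1) = A (x'' k) + B (u'' k) \<and> y'' k = C (x'' k) + D (u'' k)"
      using \<open>0 \<le> k\<close> eqs eqs'[of k] x' by (cases "k = 0") (auto simp: u''_def x''_def y''_def)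
  qed
  from available_storage_upper[OF this, of "n1 + 1"] \<open>0 \<le> n1\<close>
  have "ereal (\<Sum>k=0..n1 + 1. (norm (y'' k))\<^sup>2 - (norm (u'' k))\<^sup>2) \<le> available_storage A B C D (x n)"
    by (simp add: x''_def)
  moreover have "(\<Sum>k=0..n1 + 1. (norm (y'' k))\<^sup>2 - (norm (u'' k))\<^sup>2)
      = (norm (y n))\<^sup>2 - (norm (u n))\<^sup>2 + (\<Sum>k=1..n1 + 1. (norm (y'' k))\<^sup>2 - (norm (u'' k))\<^sup>2)"
    using \<open>0 \<le> n1\<close> by (subst sum_int_split_first) (auto simp: y''_def u''_def)
  moreover have "(\<Sum>k=1..n1 + 1. (norm (y'' k))\<^sup>2 - (norm (u'' k))\<^sup>2)
      = (\<Sum>k=0..n1. (norm (y' k))\<^sup>2 - (norm (u' k))\<^sup>2)"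
    using sum_int_shift[of "\<lambda>k. (norm (y'' k))\<^sup>2 - (norm (u'' k))\<^sup>2" 1 0 n1]
    by (simp add: y''_def u''_def)
  ultimately have "ereal (\<Sum>k=0..n1. (norm (y' k))\<^sup>2 - (norm (u' k))\<^sup>2)
      + ereal ((norm (y n))\<^sup>2 - (norm (u n))\<^sup>2) \<le> available_storage A B C D (x n)"
    by (simp add: add.commute)
  then show "ereal (\<Sum>k=0..n1. (norm (y' k))\<^sup>2 - (norm (u' k))\<^sup>2)
      \<le> available_storage A B C D (x n) + ereal ((norm (u n))\<^sup>2 - (norm (y n))\<^sup>2)"
    unfolding ereal_add_le_iff by simp
qed

lemma available_storage_is_storage:
  assumes "dissipative_at_rest A B C D"
  shows "storage_function A B C D (available_storage A B C D)"
  unfolding storage_function_def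
proof (intro conjI allI impI)
  have "available_storage A B C D 0 \<le> 0"
  proof (rule available_storage_least)
    fix u x y and n1 :: int
    assume "system_trajectory A B C D 0 u x y" "x 0 = 0"
    then have "0 \<le> (\<Sum>n=0..n1. (norm (u n))\<^sup>2 - (norm (y n))\<^sup>2)"
      using assms unfolding dissipative_at_rest_def by blast
    then show "ereal (\<Sum>n=0..n1. (norm (y n))\<^sup>2 - (norm (u n))\<^sup>2) \<le> 0"
      by (simp add: sum_subtractf)
  qed
  then show "available_storage A B C D 0 = 0"
    using available_storage_nonneg by (intro antisym)
qed (use available_storage_nonneg available_storage_step in blast)+

text \<open>
  A competitor that reaches \<open>x(n)\<close> at time 0, advanced by one time unit and followed by the step
  from \<open>x(n)\<close> to \<open>x(n+1)\<close>, is a competitor that reaches \<open>x(n+1)\<close> at time 0. If \<open>x(n)\<close>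
  cannot be reached from 0, the right-hand side is infinite.
\<close>

lemma required_supply_step:
  assumes traj: "system_trajectory A B C D N u x y" and "N \<le> n"
  shows "required_supply A B C D (x (n + 1))
    \<le> required_supply A B C D (x n) + ereal ((norm (u n))\<^sup>2 - (norm (y n))\<^sup>2)"
proof -
  have "required_supply A B C D (x (n + 1)) + ereal ((norm (y n))\<^sup>2 - (norm (u n))\<^sup>2)
      \<le> required_supply A B C D (x n)"
  proof (rule required_supply_greatest)
    fix u' x' y' and m :: int
    assume traj': "system_trajectory A B C D m u' x' y'" and "m < 0" and "x' m = 0"
      and x': "x' 0 = x n"
    \<comment> \<open>The two pieces meet at time \<open>-1\<close>: there the state is \<open>x n = x' 0\<close>, and the input is \<open>u n\<close>.\<close>
    define u'' where "u'' k = (if k < -1 then u' (k + 1) else u (n + 1 + k))" for k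
    define x'' where "x'' k = (if k < -1 then x' (k + 1) else x (n + 1 + k))" for k
    define y'' where "y'' k = (if k < -1 then y' (k + 1) else y (n + 1 + k))" for k
    have "system_trajectory A B C D (m - 1) u'' x'' y''"
      unfolding system_trajectory_def
    proof (intro allI impI)
      fix k assume k: "m - 1 \<le> k"
      have 1: "x'' (k + 1) = x' (k + 1 + 1)" if "k < -1"
        using that x' by (cases "k = -2") (auto simp: x''_def)
      have 2: "x'' (k + 1) = x (n + 1 + k + 1)" if "\<not> k < -1"
        using that by (simp add: x''_def add.assoc)
      show "x'' (k + 1) = A (x'' k) + B (u'' k) \<and> y'' k = C (x'' k) + D (u'' k)"
      proof (cases "k < -1")
        case True
        then show ?thesis
          using system_trajectoryD[OF traj', of "k + 1"] k unfolding 1[OF True]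
          by (simp add: u''_def x''_def y''_def)
      next
        case False
        then show ?thesis
          using system_trajectoryD[OF traj, of "n + 1 + k"] \<open>N \<le> n\<close> unfolding 2[OF False]
          by (simp add: u''_def x''_def y''_def)
      qed
    qed
    from required_supply_lower[OF this] \<open>m < 0\<close> \<open>x' m = 0\<close>
    have "required_supply A B C D (x (n + 1))
        \<le> ereal (\<Sum>k=m - 1..-1. (norm (u'' k))\<^sup>2 - (norm (y'' k))\<^sup>2)"
      by (simp add: x''_def)
    moreover have "(\<Sum>k=m - 1..-1. (norm (u'' k))\<^sup>2 - (norm (y'' k))\<^sup>2)
        = (\<Sum>k=m - 1..-2. (norm (u'' k))\<^sup>2 - (norm (y'' k))\<^sup>2) + ((norm (u n))\<^sup>2 - (norm (y n))\<^sup>2)"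
      using sum_int_split_last[of "m - 1" "-2" "\<lambda>k. (norm (u'' k))\<^sup>2 - (norm (y'' k))\<^sup>2"] \<open>m < 0\<close>
      by (simp add: y''_def u''_def)
    moreover have "(\<Sum>k=m - 1..-2. (norm (u'' k))\<^sup>2 - (norm (y'' k))\<^sup>2)
        = (\<Sum>k=m - 1..-2. (norm (u' (k + 1)))\<^sup>2 - (norm (y' (k + 1)))\<^sup>2)"
      by (intro sum.cong) (auto simp: y''_def u''_def)
    moreover have "\<dots> = (\<Sum>k=m..-1. (norm (u' k))\<^sup>2 - (norm (y' k))\<^sup>2)"
      using sum_int_shift[of "\<lambda>k. (norm (u' k))\<^sup>2 - (norm (y' k))\<^sup>2" 1 "m - 1" "-2"] by simp
    ultimately show "required_supply A B C D (x (n + 1)) + ereal ((norm (y n))\<^sup>2 - (norm (u n))\<^sup>2)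
        \<le> ereal (\<Sum>k=m..-1. (norm (u' k))\<^sup>2 - (norm (y' k))\<^sup>2)"
      unfolding ereal_add_le_iff by simp
  qed
  then show ?thesis
    unfolding ereal_add_le_iff by simp
qed

lemma required_supply_is_storage:
  assumes "dissipative_at_rest A B C D"
  shows "storage_function A B C D (required_supply A B C D)"
  unfolding storage_function_def
proof (intro conjI allI impI)
  show nonneg: "0 \<le> required_supply A B C D x0" for x0
    using assms by (intro required_supply_greatest) (auto simp: dissipative_at_rest_def)
  have "system_trajectory A B C D (-1) (\<lambda>_. 0) (\<lambda>_. 0) (\<lambda>_. 0)"
    by (simp add: system_trajectory_def)
  from required_supply_lower[OF this] have "required_supply A B C D 0 \<le> 0"
    by (simp flip: zero_ereal_def)
  then show "required_supply A B C D 0 = 0"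
    using nonneg by (intro antisym)
qed (rule required_supply_step)

theorem proposition4p2:
  fixes A :: "'x::complex_hilbert_space \<Rightarrow>\<^sub>L 'x"
    and B :: "'u::complex_hilbert_space \<Rightarrow>\<^sub>L 'x"
    and C :: "'x \<Rightarrow>\<^sub>L 'y::complex_hilbert_space"
    and D :: "'u \<Rightarrow>\<^sub>L 'y"
  assumes "clinear_blinfun A" "clinear_blinfun B" "clinear_blinfun C" "clinear_blinfun D"
    and "\<exists>F \<in> schur_class. \<forall>\<^sub>F z in nhds 0. F z = transfer_function A B C D z"
  shows "storage_function A B C D (available_storage A B C D) \<and>
         storage_function A B C D (required_supply A B C D) \<and>
         (\<forall>S. storage_function A B C D S \<longrightarrow>
           (\<forall>x0. available_storage A B C D x0 \<le> S x0 \<and> S x0 \<le> required_supply A B C D x0))"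
proof -
  have "dissipative_at_rest A B C D"
    using assms schur_class_dissipative_at_rest by blast
  then show ?thesis
    using available_storage_is_storage required_supply_is_storage available_storage_le
      storage_le_required_supply by blast
qed

end
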